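(* Let $\mathbb{D} : \mathcal{J} \to \mathrm{Cat}$ be a diagram of categories, put $\overline{\mathbb{D}} = \lim_{j \in \mathcal{J}} \mathbb{D}_j$ with limiting legs $((-)|_j : \overline{\mathbb{D}} \to \mathbb{D}_j)_{j \in \mathcal{J}}$, and for $\alpha : j \to j'$ in $\mathcal{J}$ write $\alpha^*$ for the functors induced by the functorial action $\mathbb{D}_\alpha : \mathbb{D}_j \to \mathbb{D}_{j'}$ on slices. Let $g : b \to a$ be a map in $\overline{\mathbb{D}}$ such that: - for every $j \in \mathcal{J}$, the restriction $g|_j : b|_j \to a|_j$ in $\mathbb{D}_j$ is powerful, with pullback functor $(g|_j)^* : \mathbb{D}_j/a|_j \to \mathbb{D}_j/b|_j$ and right adjoint $\Pi_{g|_j}$; - there is a pullback functor $g^* : \overline{\mathbb{D}}/a \to \overline{\mathbb{D}}/b$ commuting with the restrictions, i.e. $(g^*(-))|_j = (g|_j)^*((-)|_j)$ for every $j$; - for every $\alpha : j \to j'$ in $\mathcal{J}$, the pair $(\alpha^* : \mathbb{D}_j/a|_j \to \mathbb{D}_{j'}/a|_{j'},\ \alpha^* : \mathbb{D}_j/b|_j \to \mathbb{D}_{j'}/b|_{j'})$ is a map of adjunctions from $(g|_j)^* \dashv \Pi_{g|_j}$ to $(g|_{j'})^* \dashv \Pi_{g|_{j'}}$. Then $g$ is powerful, with the right adjoint $\Pi_g$ of $g^*$ given by the unique functor such that $(\Pi_g(c \xrightarrow{f} b))|_j = \Pi_{g|_j}(c|_j \xrightarrow{f|_j} b|_j)$ for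 all $j$. Furthermore, for each $j$, the restriction functors $(\overline{\mathbb{D}}/a \to \mathbb{D}_j/a|_j,\ \overline{\mathbb{D}}/b \to \mathbb{D}_j/b|_j)$ form a map of adjunctions from $g^* \dashv \Pi_g$ to $(g|_j)^* \dashv \Pi_{g|_j}$.
   Context: The limit is the (strict) limit in the category $\mathrm{Cat}$ of categories and functors. A map is *powerful* if pullbacks along it exist and the pullback functor between slices has a right adjoint. A *map of adjunctions* from $L \dashv R$ to $L' \dashv R'$ (with $L : \mathcal{A} \to \mathcal{B}$, $L' : \mathcal{A}' \to \mathcal{B}'$) is a pair of functors $H : \mathcal{A} \to \mathcal{A}'$, $K : \mathcal{B} \to \mathcal{B}'$ with $KL = L'H$, $HR = R'K$ and compatible with the units (equivalently the counits). *)

theory Defs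
  imports "HOL-Library.FuncSet"
begin

section \<open>Categories and functors\<close>

text \<open>Categories are given by carrier sets inside a type of objects and a type of arrows.
  \<open>Cmp C g f\<close> is the composite of \<open>f\<close> followed by \<open>g\<close>.\<close>

record ('o, 'm) cat =
  Ob :: "'o set"
  Ar :: "'m set"
  Dom :: "'m \<Rightarrow> 'o"
  Cod :: "'m \<Rightarrow> 'o"
  Ide :: "'o \<Rightarrow> 'm"
  Cmp :: "'m \<Rightarrow> 'm \<Rightarrow> 'm"

definition hom :: "('o, 'm) cat \<Rightarrow> 'o \<Rightarrow> 'o \<Rightarrow> 'm set" where
  "hom C x y = {f \<in> Ar C. Dom C f = x \<and> Cod C f = y}"

locale category =
  fixes C :: "('o, 'm) cat"
  assumes Dom_in: "f \<in> Ar C \<Longrightarrow> Dom C f \<in> Ob C"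
    and Cod_in: "f \<in> Ar C \<Longrightarrow> Cod C f \<in> Ob C"
    and Ide_in: "x \<in> Ob C \<Longrightarrow> Ide C x \<in> hom C x x"
    and Cmp_in: "f \<in> hom C x y \<Longrightarrow> g \<in> hom C y z \<Longrightarrow> Cmp C g f \<in> hom C x z"
    and Cmp_Ide: "f \<in> Ar C \<Longrightarrow> Cmp C f (Ide C (Dom C f)) = f"
    and Ide_Cmp: "f \<in> Ar C \<Longrightarrow> Cmp C (Ide C (Cod C f)) f = f"
    and Cmp_assoc: "f \<in> hom C w x \<Longrightarrow> g \<in> hom C x y \<Longrightarrow> h \<in> hom C y z \<Longrightarrow>
      Cmp C h (Cmp C g f) = Cmp C (Cmp C h g) f"

record ('o, 'm, 'p, 'n) funct =
  onOb :: "'o \<Rightarrow> 'p"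
  onAr :: "'m \<Rightarrow> 'n"

definition is_functor ::
  "('o, 'm) cat \<Rightarrow> ('p, 'n) cat \<Rightarrow> ('o, 'm, 'p, 'n) funct \<Rightarrow> bool" where
  "is_functor C D F \<longleftrightarrow> category C \<and> category D \<and>
     (\<forall>x \<in> Ob C. onOb F x \<in> Ob D) \<and>
     (\<forall>f \<in> Ar C. onAr F f \<in> hom D (onOb F (Dom C f)) (onOb F (Cod C f))) \<and>
     (\<forall>x \<in> Ob C. onAr F (Ide C x) = Ide D (onOb F x)) \<and>
     (\<forall>f \<in> Ar C. \<forall>g \<in> Ar C. Cod C f = Dom C g \<longrightarrow>
        onAr F (Cmp C g f) = Cmp D (onAr F g) (onAr F f))"

text \<open>The maps underlying a functor are arbitrary outside the carriers of its source, so
  equality of functors means agreement on these carriers.\<close>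

definition functor_eq ::
  "('o, 'm) cat \<Rightarrow> ('o, 'm, 'p, 'n) funct \<Rightarrow> ('o, 'm, 'p, 'n) funct \<Rightarrow> bool" where
  "functor_eq C F G \<longleftrightarrow>
     (\<forall>x \<in> Ob C. onOb F x = onOb G x) \<and> (\<forall>f \<in> Ar C. onAr F f = onAr G f)"

definition id_functor :: "('o, 'm, 'o, 'm) funct" where
  "id_functor = \<lparr>onOb = (\<lambda>x. x), onAr = (\<lambda>f. f)\<rparr>"

definition comp_functor ::
  "('p, 'n, 'q, 'r) funct \<Rightarrow> ('o, 'm, 'p, 'n) funct \<Rightarrow> ('o, 'm, 'q, 'r) funct" where
  "comp_functor G F = \<lparr>onOb = onOb G \<circ> onOb F, onAr = onAr G \<circ> onAr F\<rparr>"


section \<open>Diagrams of categories and their strict limit\<close>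

text \<open>A functor from \<open>J\<close> to the category of categories: \<open>D\<close> is its action on objects and
  \<open>T\<close> its action on arrows.  All the \<open>D j\<close> share the same ambient types, but have
  independent carriers.\<close>

definition diagram ::
  "('j, 'k) cat \<Rightarrow> ('j \<Rightarrow> ('o, 'm) cat) \<Rightarrow> ('k \<Rightarrow> ('o, 'm, 'o, 'm) funct) \<Rightarrow> bool" where
  "diagram J D T \<longleftrightarrow> category J \<and>
     (\<forall>j \<in> Ob J. category (D j)) \<and>
     (\<forall>\<alpha> \<in> Ar J. is_functor (D (Dom J \<alpha>)) (D (Cod J \<alpha>)) (T \<alpha>)) \<and>
     (\<forall>j \<in> Ob J. functor_eq (D j) (T (Ide J j)) id_functor) \<and>
     (\<forall>\<alpha> \<in> Ar J. \<forall>\<beta> \<in> Ar J. Cod J \<alpha> = Dom J \<beta> \<longrightarrow>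
        functor_eq (D (Dom J \<alpha>)) (T (Cmp J \<beta> \<alpha>)) (comp_functor (T \<beta>) (T \<alpha>)))"

text \<open>The strict limit: objects and arrows are the compatible families, taken extensional
  (\<open>undefined\<close> outside \<open>Ob J\<close>) so that they are determined by their components.
  That it has the universal property of the limit, against test categories of arbitrary
  types, is \<open>limit_cat_cone\<close> and \<open>limit_cat_universal\<close> below.\<close>

definition limit_cat ::
  "('j, 'k) cat \<Rightarrow> ('j \<Rightarrow> ('o, 'm) cat) \<Rightarrow> ('k \<Rightarrow> ('o, 'm, 'o, 'm) funct)
    \<Rightarrow> ('j \<Rightarrow> 'o, 'j \<Rightarrow> 'm) cat" where
  "limit_cat J D T =
     \<lparr>Ob = {x \<in> (\<Pi>\<^sub>E j \<in> Ob J. Ob (D j)).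
              \<forall>\<alpha> \<in> Ar J. onOb (T \<alpha>) (x (Dom J \<alpha>)) = x (Cod J \<alpha>)},
      Ar = {f \<in> (\<Pi>\<^sub>E j \<in> Ob J. Ar (D j)).
              \<forall>\<alpha> \<in> Ar J. onAr (T \<alpha>) (f (Dom J \<alpha>)) = f (Cod J \<alpha>)},
      Dom = (\<lambda>f. \<lambda>j \<in> Ob J. Dom (D j) (f j)),
      Cod = (\<lambda>f. \<lambda>j \<in> Ob J. Cod (D j) (f j)),
      Ide = (\<lambda>x. \<lambda>j \<in> Ob J. Ide (D j) (x j)),
      Cmp = (\<lambda>g f. \<lambda>j \<in> Ob J. Cmp (D j) (g j) (f j))\<rparr>"

definition leg :: "'j \<Rightarrow> ('j \<Rightarrow> 'o, 'j \<Rightarrow> 'm, 'o, 'm) funct" where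
  "leg j = \<lparr>onOb = (\<lambda>x. x j), onAr = (\<lambda>f. f j)\<rparr>"


section \<open>Slices\<close>

text \<open>Objects of the slice over \<open>a\<close> are the arrows into \<open>a\<close>; an arrow from \<open>f\<close> to \<open>f'\<close>
  is a triple \<open>(f, h, f')\<close> with \<open>f' \<circ> h = f\<close>.\<close>

definition slice :: "('o, 'm) cat \<Rightarrow> 'o \<Rightarrow> ('m, 'm \<times> 'm \<times> 'm) cat" where
  "slice C a =
     \<lparr>Ob = {f \<in> Ar C. Cod C f = a},
      Ar = {(f, h, f'). f \<in> Ar C \<and> Cod C f = a \<and> f' \<in> Ar C \<and> Cod C f' = a \<and>
              h \<in> hom C (Dom C f) (Dom C f') \<and> Cmp C f' h = f},
      Dom = (\<lambda>(f, h, f'). f),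
      Cod = (\<lambda>(f, h, f'). f'),
      Ide = (\<lambda>f. (f, Ide C (Dom C f), f)),
      Cmp = (\<lambda>(f', k, f'') (f, h, _). (f, Cmp C k h, f''))\<rparr>"

definition underlying :: "'m \<times> 'm \<times> 'm \<Rightarrow> 'm" where
  "underlying t = fst (snd t)"

text \<open>The functor induced by \<open>F\<close> from the slice over any \<open>a\<close> to the slice over
  \<open>onOb F a\<close>.\<close>

definition slice_functor ::
  "('o, 'm, 'p, 'n) funct \<Rightarrow> ('m, 'm \<times> 'm \<times> 'm, 'n, 'n \<times> 'n \<times> 'n) funct" where
  "slice_functor F =
     \<lparr>onOb = onAr F, onAr = (\<lambda>(f, h, f'). (onAr F f, onAr F h, onAr F f'))\<rparr>"


section \<open>Adjunctions and their maps\<close>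

record ('ao, 'am, 'bo, 'bm) adj =
  ladj :: "('ao, 'am, 'bo, 'bm) funct"
  radj :: "('bo, 'bm, 'ao, 'am) funct"
  adj_unit :: "'ao \<Rightarrow> 'am"
  adj_counit :: "'bo \<Rightarrow> 'bm"

definition nat_trans ::
  "('o, 'm) cat \<Rightarrow> ('p, 'n) cat \<Rightarrow> ('o, 'm, 'p, 'n) funct \<Rightarrow> ('o, 'm, 'p, 'n) funct
    \<Rightarrow> ('o \<Rightarrow> 'n) \<Rightarrow> bool" where
  "nat_trans C D F G \<tau> \<longleftrightarrow>
     is_functor C D F \<and> is_functor C D G \<and>
     (\<forall>x \<in> Ob C. \<tau> x \<in> hom D (onOb F x) (onOb G x)) \<and>
     (\<forall>f \<in> Ar C. Cmp D (onAr G f) (\<tau> (Dom C f)) = Cmp D (\<tau> (Cod C f)) (onAr F f))"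

definition adjunction ::
  "('ao, 'am) cat \<Rightarrow> ('bo, 'bm) cat \<Rightarrow> ('ao, 'am, 'bo, 'bm) adj \<Rightarrow> bool" where
  "adjunction A B X \<longleftrightarrow>
     is_functor A B (ladj X) \<and> is_functor B A (radj X) \<and>
     nat_trans A A id_functor (comp_functor (radj X) (ladj X)) (adj_unit X) \<and>
     nat_trans B B (comp_functor (ladj X) (radj X)) id_functor (adj_counit X) \<and>
     (\<forall>x \<in> Ob A. Cmp B (adj_counit X (onOb (ladj X) x)) (onAr (ladj X) (adj_unit X x))
        = Ide B (onOb (ladj X) x)) \<and>
     (\<forall>y \<in> Ob B. Cmp A (onAr (radj X) (adj_counit X y)) (adj_unit X (onOb (radj X) y))
        = Ide A (onOb (radj X) y))"

definition map_of_adjunctions ::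
  "('ao, 'am) cat \<Rightarrow> ('bo, 'bm) cat \<Rightarrow> ('ao, 'am, 'bo, 'bm) adj
    \<Rightarrow> ('co, 'cm) cat \<Rightarrow> ('do, 'dm) cat \<Rightarrow> ('co, 'cm, 'do, 'dm) adj
    \<Rightarrow> ('ao, 'am, 'co, 'cm) funct \<Rightarrow> ('bo, 'bm, 'do, 'dm) funct \<Rightarrow> bool" where
  "map_of_adjunctions A B X A' B' X' H K \<longleftrightarrow>
     adjunction A B X \<and> adjunction A' B' X' \<and>
     is_functor A A' H \<and> is_functor B B' K \<and>
     functor_eq A (comp_functor K (ladj X)) (comp_functor (ladj X') H) \<and>
     functor_eq B (comp_functor H (radj X)) (comp_functor (radj X') K) \<and>
     (\<forall>x \<in> Ob A. onAr H (adj_unit X x) = adj_unit X' (onOb H x))"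


section \<open>Powerful maps\<close>

text \<open>\<open>is_pullback C f g p q\<close>: the square \<open>f \<circ> p = g \<circ> q\<close> is a pullback of the cospan
  \<open>(f, g)\<close>.\<close>

definition is_pullback :: "('o, 'm) cat \<Rightarrow> 'm \<Rightarrow> 'm \<Rightarrow> 'm \<Rightarrow> 'm \<Rightarrow> bool" where
  "is_pullback C f g p q \<longleftrightarrow>
     f \<in> Ar C \<and> g \<in> Ar C \<and> Cod C f = Cod C g \<and>
     p \<in> hom C (Dom C p) (Dom C f) \<and> q \<in> hom C (Dom C p) (Dom C g) \<and>
     Cmp C f p = Cmp C g q \<and>
     (\<forall>t \<in> Ob C. \<forall>u \<in> hom C t (Dom C f). \<forall>v \<in> hom C t (Dom C g).
        Cmp C f u = Cmp C g v \<longrightarrow>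
        (\<exists>!w. w \<in> hom C t (Dom C p) \<and> Cmp C p w = u \<and> Cmp C q w = v))"

definition has_pullbacks_along :: "('o, 'm) cat \<Rightarrow> 'm \<Rightarrow> bool" where
  "has_pullbacks_along C g \<longleftrightarrow>
     g \<in> Ar C \<and> (\<forall>f \<in> Ar C. Cod C f = Cod C g \<longrightarrow> (\<exists>p q. is_pullback C f g p q))"

text \<open>A functor between the slices is a pullback functor along \<open>g\<close> if it arises from a
  choice of pullback squares, i.e. there are projections \<open>p f\<close> exhibiting each \<open>onOb G f\<close> as
  a pullback of \<open>f\<close> along \<open>g\<close> such that \<open>G\<close> acts on arrows by the maps that commute with
  the projections.\<close>

definition is_pullback_functor ::
  "('o, 'm) cat \<Rightarrow> 'm \<Rightarrow> ('m, 'm \<times> 'm \<times> 'm, 'm, 'm \<times> 'm \<times> 'm) funct \<Rightarrow> bool" where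
  "is_pullback_functor C g G \<longleftrightarrow>
     g \<in> Ar C \<and> is_functor (slice C (Cod C g)) (slice C (Dom C g)) G \<and>
     (\<exists>p. (\<forall>f \<in> Ob (slice C (Cod C g)). is_pullback C f g (p f) (onOb G f)) \<and>
          (\<forall>(f, h, f') \<in> Ar (slice C (Cod C g)).
             Cmp C (p f') (underlying (onAr G (f, h, f'))) = Cmp C h (p f)))"

text \<open>\<open>g\<close> is powerful, with pullback functor \<open>ladj X\<close> and right adjoint \<open>radj X\<close>.\<close>

definition powerful_with ::
  "('o, 'm) cat \<Rightarrow> 'm \<Rightarrow> ('m, 'm \<times> 'm \<times> 'm, 'm, 'm \<times> 'm \<times> 'm) adj \<Rightarrow> bool" where
  "powerful_with C g X \<longleftrightarrow>
     has_pullbacks_along C g \<and> is_pullback_functor C g (ladj X) \<and>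
     adjunction (slice C (Cod C g)) (slice C (Dom C g)) X"

definition powerful :: "('o, 'm) cat \<Rightarrow> 'm \<Rightarrow> bool" where
  "powerful C g \<longleftrightarrow> (\<exists>X. powerful_with C g X)"


section \<open>The constructions above are well defined\<close>

lemma category_slice:
  assumes "category C"
  shows "category (slice C a)"
proof -
  interpret category C by fact
  have comp: "Cmp C k h \<in> Ar C \<and> Dom C (Cmp C k h) = Dom C h \<and> Cod C (Cmp C k h) = Cod C k"
    if "h \<in> Ar C" "k \<in> Ar C" "Cod C h = Dom C k" for h k
    using Cmp_in[of h "Dom C h" "Cod C h" k "Cod C k"] that by (simp add: hom_def)
  have assoc: "Cmp C (Cmp C k h) f = Cmp C k (Cmp C h f)"
    if "f \<in> Ar C" "h \<in> Ar C" "k \<in> Ar C" "Cod C f = Dom C h" "Cod C h = Dom C k" for f h k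
    using Cmp_assoc[of f "Dom C f" "Cod C f" h "Cod C h" k "Cod C k"] that
    by (simp add: hom_def)
  have ident: "Ide C x \<in> Ar C \<and> Dom C (Ide C x) = x \<and> Cod C (Ide C x) = x" if "x \<in> Ob C" for x
    using Ide_in[OF that] by (simp add: hom_def)
  show ?thesis
  proof
    fix f x y g z
    assume f: "f \<in> hom (slice C a) x y" and g: "g \<in> hom (slice C a) y z"
    obtain h where h: "f = (x, h, y)" "x \<in> Ar C" "Cod C x = a" "y \<in> Ar C" "Cod C y = a"
        "h \<in> Ar C" "Dom C h = Dom C x" "Cod C h = Dom C y" "Cmp C y h = x"
      using f by (auto simp: slice_def hom_def)
    obtain k where k: "g = (y, k, z)" "z \<in> Ar C" "Cod C z = a"
        "k \<in> Ar C" "Dom C k = Dom C y" "Cod C k = Dom C z" "Cmp C z k = y"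
      using g by (auto simp: slice_def hom_def)
    have "Cmp C z (Cmp C k h) = x"
      using assoc[of h k z] h k by simp
    then show "Cmp (slice C a) g f \<in> hom (slice C a) x z"
      using h k comp[of h k] by (simp add: slice_def hom_def)
  next
    fix f w x g y h z
    assume "f \<in> hom (slice C a) w x" "g \<in> hom (slice C a) x y" "h \<in> hom (slice C a) y z"
    then show "Cmp (slice C a) h (Cmp (slice C a) g f)
        = Cmp (slice C a) (Cmp (slice C a) h g) f"
      by (auto simp: slice_def hom_def assoc)
  next
    fix x assume "x \<in> Ob (slice C a)"
    then show "Ide (slice C a) x \<in> hom (slice C a) x x"
      using ident[of "Dom C x"] by (auto simp: slice_def hom_def Dom_in Cmp_Ide)
  next
    fix f assume "f \<in> Ar (slice C a)"
    then show "Cmp (slice C a) f (Ide (slice C a) (Dom (slice C a) f)) = f"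
      using Cmp_Ide[of "fst (snd f)"] by (auto simp: slice_def hom_def)
  next
    fix f assume "f \<in> Ar (slice C a)"
    then show "Cmp (slice C a) (Ide (slice C a) (Cod (slice C a) f)) f = f"
      using Ide_Cmp[of "fst (snd f)"] by (auto simp: slice_def hom_def)
  qed (auto simp: slice_def)
qed

lemma is_functor_slice_functor:
  assumes "is_functor C D F"
  shows "is_functor (slice C a) (slice D (onOb F a)) (slice_functor F)"
proof -
  have C: "category C" and D: "category D" and
    F: "\<And>f. f \<in> Ar C \<Longrightarrow> onAr F f \<in> Ar D \<and> Dom D (onAr F f) = onOb F (Dom C f)
          \<and> Cod D (onAr F f) = onOb F (Cod C f)"
       "\<And>x. x \<in> Ob C \<Longrightarrow> onAr F (Ide C x) = Ide D (onOb F x)"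
       "\<And>f g. f \<in> Ar C \<Longrightarrow> g \<in> Ar C \<Longrightarrow> Cod C f = Dom C g \<Longrightarrow>
          onAr F (Cmp C g f) = Cmp D (onAr F g) (onAr F f)"
    using assms by (auto simp: is_functor_def hom_def)
  have "Cmp D (onAr F f) (onAr F h) = onAr F (Cmp C f h)"
    if "f \<in> Ar C" "h \<in> Ar C" "Cod C h = Dom C f" for f h
    using F(3) that by simp
  then show ?thesis
    using F category.Dom_in[OF C] category_slice[OF C, of a] category_slice[OF D, of "onOb F a"]
    unfolding is_functor_def by (auto simp: slice_def slice_functor_def hom_def)
qed

lemma category_limit_cat:
  assumes "diagram J D T"
  shows "category (limit_cat J D T)"
proof -
  let ?L = "limit_cat J D T"
  have J: "category J" and D: "\<And>j. j \<in> Ob J \<Longrightarrow> category (D j)"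
    and T: "\<And>\<alpha>. \<alpha> \<in> Ar J \<Longrightarrow> is_functor (D (Dom J \<alpha>)) (D (Cod J \<alpha>)) (T \<alpha>)"
    using assms by (auto simp: diagram_def)
  have ObJ: "Dom J \<alpha> \<in> Ob J" "Cod J \<alpha> \<in> Ob J" if "\<alpha> \<in> Ar J" for \<alpha>
    using category.Dom_in[OF J that] category.Cod_in[OF J that] by auto
  have Tdc: "onOb (T \<alpha>) (Dom (D (Dom J \<alpha>)) f) = Dom (D (Cod J \<alpha>)) (onAr (T \<alpha>) f)"
    "onOb (T \<alpha>) (Cod (D (Dom J \<alpha>)) f) = Cod (D (Cod J \<alpha>)) (onAr (T \<alpha>) f)"
    if "\<alpha> \<in> Ar J" "f \<in> Ar (D (Dom J \<alpha>))" for \<alpha> f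
    using T[OF that(1)] that(2) by (auto simp: is_functor_def hom_def)
  have hom_iff: "f \<in> hom ?L x y \<longleftrightarrow> f \<in> Ar ?L \<and> x \<in> extensional (Ob J) \<and>
      y \<in> extensional (Ob J) \<and> (\<forall>j \<in> Ob J. f j \<in> hom (D j) (x j) (y j))" for f x y
    by (auto simp: hom_def limit_cat_def PiE_iff intro!: extensionalityI[of _ "Ob J"])
  show ?thesis
  proof
    fix f assume f: "f \<in> Ar ?L"
    then show "Dom ?L f \<in> Ob ?L" "Cod ?L f \<in> Ob ?L"
      using D ObJ Tdc
      by (auto simp: limit_cat_def PiE_iff category.Dom_in category.Cod_in)
    have fj: "f j \<in> Ar (D j)" if "j \<in> Ob J" for j
      using f that by (auto simp: limit_cat_def PiE_iff)
    have ext: "f \<in> extensional (Ob J)"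
      using f by (auto simp: limit_cat_def PiE_iff)
    show "Cmp ?L f (Ide ?L (Dom ?L f)) = f"
      by (rule extensionalityI[OF _ ext])
        (auto simp: limit_cat_def category.Cmp_Ide[OF D] fj)
    show "Cmp ?L (Ide ?L (Cod ?L f)) f = f"
      by (rule extensionalityI[OF _ ext])
        (auto simp: limit_cat_def category.Ide_Cmp[OF D] fj)
  next
    fix x assume x: "x \<in> Ob ?L"
    have "Ide (D j) (x j) \<in> hom (D j) (x j) (x j)" if "j \<in> Ob J" for j
      using x that by (intro category.Ide_in[OF D]) (auto simp: limit_cat_def PiE_iff)
    moreover have "onAr (T \<alpha>) (Ide (D (Dom J \<alpha>)) (x (Dom J \<alpha>)))
        = Ide (D (Cod J \<alpha>)) (x (Cod J \<alpha>))" if "\<alpha> \<in> Ar J" for \<alpha>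
      using x that T[OF that] ObJ[OF that] by (auto simp: is_functor_def limit_cat_def PiE_iff)
    ultimately show "Ide ?L x \<in> hom ?L x x"
      using x ObJ unfolding hom_iff by (auto simp: limit_cat_def hom_def PiE_iff)
  next
    fix f x y g z
    assume f: "f \<in> hom ?L x y" and g: "g \<in> hom ?L y z"
    have "Cmp (D j) (g j) (f j) \<in> hom (D j) (x j) (z j)" if "j \<in> Ob J" for j
      using f g that by (auto simp: hom_iff intro: category.Cmp_in[OF D])
    moreover have "onAr (T \<alpha>) (Cmp (D (Dom J \<alpha>)) (g (Dom J \<alpha>)) (f (Dom J \<alpha>)))
        = Cmp (D (Cod J \<alpha>)) (g (Cod J \<alpha>)) (f (Cod J \<alpha>))" if \<alpha>: "\<alpha> \<in> Ar J" for \<alpha>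
    proof -
      have "f (Dom J \<alpha>) \<in> hom (D (Dom J \<alpha>)) (x (Dom J \<alpha>)) (y (Dom J \<alpha>))"
        "g (Dom J \<alpha>) \<in> hom (D (Dom J \<alpha>)) (y (Dom J \<alpha>)) (z (Dom J \<alpha>))"
        using f g ObJ[OF \<alpha>] by (auto simp: hom_iff)
      moreover have "onAr (T \<alpha>) (f (Dom J \<alpha>)) = f (Cod J \<alpha>)" "onAr (T \<alpha>) (g (Dom J \<alpha>)) = g (Cod J \<alpha>)"
        using f g \<alpha> by (auto simp: hom_def limit_cat_def)
      ultimately show ?thesis
        using T[OF \<alpha>] by (auto simp: is_functor_def hom_def)
    qed
    ultimately show "Cmp ?L g f \<in> hom ?L x z"
      using f g ObJ unfolding hom_iff by (auto simp: limit_cat_def hom_def PiE_iff)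
  next
    fix f w x g y h z
    assume "f \<in> hom ?L w x" "g \<in> hom ?L x y" "h \<in> hom ?L y z"
    then have "Cmp (D j) (h j) (Cmp (D j) (g j) (f j)) = Cmp (D j) (Cmp (D j) (h j) (g j)) (f j)"
      if "j \<in> Ob J" for j
      using that by (intro category.Cmp_assoc[OF D]) (auto simp: hom_iff)
    then show "Cmp ?L h (Cmp ?L g f) = Cmp ?L (Cmp ?L h g) f"
      by (auto simp: limit_cat_def)
  qed
qed

lemma limit_cat_cone:
  assumes "diagram J D T"
  shows "j \<in> Ob J \<Longrightarrow> is_functor (limit_cat J D T) (D j) (leg j)"
    and "\<alpha> \<in> Ar J \<Longrightarrow> functor_eq (limit_cat J D T)
      (comp_functor (T \<alpha>) (leg (Dom J \<alpha>))) (leg (Cod J \<alpha>))"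
  using assms category_limit_cat[OF assms]
  by (auto simp: is_functor_def functor_eq_def comp_functor_def leg_def limit_cat_def
      hom_def PiE_iff diagram_def)

lemma limit_cat_universal:
  assumes "diagram J D T" and "category E"
    and F: "\<And>j. j \<in> Ob J \<Longrightarrow> is_functor E (D j) (F j)"
    and cone: "\<And>\<alpha>. \<alpha> \<in> Ar J \<Longrightarrow>
      functor_eq E (comp_functor (T \<alpha>) (F (Dom J \<alpha>))) (F (Cod J \<alpha>))"
  shows "\<exists>U. is_functor E (limit_cat J D T) U \<and>
    (\<forall>j \<in> Ob J. functor_eq E (comp_functor (leg j) U) (F j)) \<and>
    (\<forall>V. is_functor E (limit_cat J D T) V \<and>
         (\<forall>j \<in> Ob J. functor_eq E (comp_functor (leg j) V) (F j)) \<longrightarrow>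
       functor_eq E V U)"
proof -
  let ?L = "limit_cat J D T"
  define U where "U = \<lparr>onOb = (\<lambda>x. \<lambda>j \<in> Ob J. onOb (F j) x),
    onAr = (\<lambda>f. \<lambda>j \<in> Ob J. onAr (F j) f)\<rparr>"
  have J: "category J" using assms(1) by (simp add: diagram_def)
  have ObJ: "Dom J \<alpha> \<in> Ob J" "Cod J \<alpha> \<in> Ob J" if "\<alpha> \<in> Ar J" for \<alpha>
    using category.Dom_in[OF J that] category.Cod_in[OF J that] by auto
  have "is_functor E ?L U"
    using F cone ObJ category_limit_cat[OF assms(1)] \<open>category E\<close>
      category.Dom_in[OF \<open>category E\<close>] category.Cod_in[OF \<open>category E\<close>]
    unfolding is_functor_def
    by (auto simp: U_def limit_cat_def hom_def PiE_iff functor_eq_def comp_functor_def)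
  moreover have "\<forall>j \<in> Ob J. functor_eq E (comp_functor (leg j) U) (F j)"
    by (simp add: functor_eq_def comp_functor_def leg_def U_def)
  moreover have "functor_eq E V U" if V: "is_functor E ?L V"
    and eq: "\<forall>j \<in> Ob J. functor_eq E (comp_functor (leg j) V) (F j)" for V
  proof -
    have "onOb V x = onOb U x" if "x \<in> Ob E" for x
    proof (rule extensionalityI)
      show "onOb V x \<in> extensional (Ob J)"
        using V that by (auto simp: is_functor_def limit_cat_def PiE_iff)
    qed (use eq that in \<open>auto simp: U_def functor_eq_def comp_functor_def leg_def\<close>)
    moreover have "onAr V f = onAr U f" if "f \<in> Ar E" for f
    proof (rule extensionalityI)
      show "onAr V f \<in> extensional (Ob J)"
        using V that by (auto simp: is_functor_def hom_def limit_cat_def PiE_iff)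
    qed (use eq that in \<open>auto simp: U_def functor_eq_def comp_functor_def leg_def\<close>)
    ultimately show ?thesis by (simp add: functor_eq_def)
  qed
  ultimately show ?thesis by blast
qed

end

theory Submission
  imports Defs
begin

text \<open>The slice of a strict limit is the strict limit of the slices. A map of adjunctions
  preserves counits as well as units, so the composites of the restrictions with the
  \<open>\<Pi>\<^sub>j\<close>, and the units and counits at the restrictions, are compatible families and therefore
  lift to the limit; the triangle identities hold because they hold in every component.\<close>

section \<open>Rules for functors, natural transformations and adjunctions\<close>

lemma is_functorD:
  assumes "is_functor C D F"
  shows "category C" "category D"
    and "x \<in> Ob C \<Longrightarrow> onOb F x \<in> Ob D"
    and "f \<in> Ar C \<Longrightarrow> onAr F f \<in> Ar D"
    and "f \<in> Ar C \<Longrightarrow> Dom D (onAr F f) = onOb F (Dom C f)"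
    and "f \<in> Ar C \<Longrightarrow> Cod D (onAr F f) = onOb F (Cod C f)"
    and "x \<in> Ob C \<Longrightarrow> onAr F (Ide C x) = Ide D (onOb F x)"
    and "f \<in> hom C x y \<Longrightarrow> onAr F f \<in> hom D (onOb F x) (onOb F y)"
    and "f \<in> hom C x y \<Longrightarrow> g \<in> hom C y z \<Longrightarrow>
      onAr F (Cmp C g f) = Cmp D (onAr F g) (onAr F f)"
  using assms by (auto simp: is_functor_def hom_def)

lemma is_functorI:
  assumes "category C" "category D"
    and "\<And>x. x \<in> Ob C \<Longrightarrow> onOb F x \<in> Ob D"
    and "\<And>f. f \<in> Ar C \<Longrightarrow> onAr F f \<in> hom D (onOb F (Dom C f)) (onOb F (Cod C f))"
    and "\<And>x. x \<in> Ob C \<Longrightarrow> onAr F (Ide C x) = Ide D (onOb F x)"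
    and "\<And>f g. f \<in> Ar C \<Longrightarrow> g \<in> Ar C \<Longrightarrow> Cod C f = Dom C g \<Longrightarrow>
      onAr F (Cmp C g f) = Cmp D (onAr F g) (onAr F f)"
  shows "is_functor C D F"
  using assms by (simp add: is_functor_def)

lemma comp_functor_simps [simp]:
  "onOb (comp_functor G F) x = onOb G (onOb F x)"
  "onAr (comp_functor G F) f = onAr G (onAr F f)"
  by (simp_all add: comp_functor_def)

lemma id_functor_simps [simp]: "onOb id_functor x = x" "onAr id_functor f = f"
  by (simp_all add: id_functor_def)

lemma leg_simps [simp]: "onOb (leg j) x = x j" "onAr (leg j) f = f j"
  by (simp_all add: leg_def)

lemma is_functor_id: "category C \<Longrightarrow> is_functor C C id_functor"
  by (auto simp: is_functor_def hom_def)

lemma is_functor_comp: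
  assumes F: "is_functor C D F" and G: "is_functor D E G"
  shows "is_functor C E (comp_functor G F)"
  using assms by (auto simp: is_functor_def hom_def)

lemma functor_eqD:
  assumes "functor_eq C F G"
  shows "x \<in> Ob C \<Longrightarrow> onOb F x = onOb G x"
    and "f \<in> Ar C \<Longrightarrow> onAr F f = onAr G f"
  using assms by (auto simp: functor_eq_def)

lemma nat_transD:
  assumes "nat_trans C D F G \<tau>"
  shows "is_functor C D F" "is_functor C D G"
    and "x \<in> Ob C \<Longrightarrow> \<tau> x \<in> hom D (onOb F x) (onOb G x)"
    and "f \<in> hom C x y \<Longrightarrow> Cmp D (onAr G f) (\<tau> x) = Cmp D (\<tau> y) (onAr F f)"
  using assms by (auto simp: nat_trans_def hom_def)

lemma adjunctionD:
  assumes "adjunction A B X"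
  shows "is_functor A B (ladj X)" "is_functor B A (radj X)"
    and "x \<in> Ob A \<Longrightarrow> adj_unit X x \<in> hom A x (onOb (radj X) (onOb (ladj X) x))"
    and "y \<in> Ob B \<Longrightarrow> adj_counit X y \<in> hom B (onOb (ladj X) (onOb (radj X) y)) y"
    and "f \<in> hom A x x' \<Longrightarrow>
      Cmp A (onAr (radj X) (onAr (ladj X) f)) (adj_unit X x) = Cmp A (adj_unit X x') f"
    and "h \<in> hom B y y' \<Longrightarrow>
      Cmp B h (adj_counit X y) = Cmp B (adj_counit X y') (onAr (ladj X) (onAr (radj X) h))"
    and "x \<in> Ob A \<Longrightarrow> Cmp B (adj_counit X (onOb (ladj X) x)) (onAr (ladj X) (adj_unit X x))
      = Ide B (onOb (ladj X) x)"
    and "y \<in> Ob B \<Longrightarrow> Cmp A (onAr (radj X) (adj_counit X y)) (adj_unit X (onOb (radj X) y))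
      = Ide A (onOb (radj X) y)"
  using assms by (auto simp: adjunction_def nat_trans_def hom_def)

section \<open>Transposes, and counits under a map of adjunctions\<close>

text \<open>Naturality of the counit moves \<open>u\<close> to the outside, and the triangle
  identity at \<open>z\<close> cancels the rest. Hence a map out of \<open>onOb (ladj X) z\<close>
  is determined by its transpose, which is what identifies counits below.\<close>

lemma adjunction_untranspose:
  assumes X: "adjunction A B X" and z: "z \<in> Ob A" and y: "y \<in> Ob B"
    and u: "u \<in> hom B (onOb (ladj X) z) y"
  shows "Cmp B (adj_counit X y)
    (onAr (ladj X) (Cmp A (onAr (radj X) u) (adj_unit X z))) = u"
proof -
  note adj = adjunctionD[OF X]
  note l = is_functorD[OF adj(1)] and r = is_functorD[OF adj(2)]
  let ?L = "onAr (ladj X)"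
  note Ru = r(8)[OF u] and \<eta> = adj(3)[OF z]
  have "Cmp B (adj_counit X y) (?L (Cmp A (onAr (radj X) u) (adj_unit X z)))
      = Cmp B (adj_counit X y) (Cmp B (?L (onAr (radj X) u)) (?L (adj_unit X z)))"
    using l(9)[OF \<eta> Ru] by simp
  also have "\<dots> = Cmp B (Cmp B (adj_counit X y) (?L (onAr (radj X) u))) (?L (adj_unit X z))"
    by (rule category.Cmp_assoc[OF l(2) l(8)[OF \<eta>] l(8)[OF Ru] adj(4)[OF y]])
  also have "\<dots> = Cmp B (Cmp B u (adj_counit X (onOb (ladj X) z))) (?L (adj_unit X z))"
    using adj(6)[OF u] by simp
  also have "\<dots> = Cmp B u (Cmp B (adj_counit X (onOb (ladj X) z)) (?L (adj_unit X z)))"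
    by (rule category.Cmp_assoc[OF l(2) l(8)[OF \<eta>] adj(4)[OF l(3)[OF z]] u, symmetric])
  also have "\<dots> = u"
    using adj(7)[OF z] u category.Cmp_Ide[OF l(2), of u] by (simp add: hom_def)
  finally show ?thesis .
qed

text \<open>Both sides are maps with the same source and target whose transpose under
  \<open>X'\<close> is an identity: the right side by a triangle identity of \<open>X'\<close>, the
  left side because \<open>H\<close> preserves the corresponding triangle identity of
  \<open>X\<close>. So preservation of units entails preservation of counits.\<close>

lemma map_of_adjunctions_counit:
  assumes M: "map_of_adjunctions A B X A' B' X' H K" and y: "y \<in> Ob B"
  shows "onAr K (adj_counit X y) = adj_counit X' (onOb K y)"
proof -
  have X: "adjunction A B X" and X': "adjunction A' B' X'"
    and H: "is_functor A A' H" and K: "is_functor B B' K"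
    and KL: "functor_eq A (comp_functor K (ladj X)) (comp_functor (ladj X') H)"
    and HR: "functor_eq B (comp_functor H (radj X)) (comp_functor (radj X') K)"
    and unit: "\<And>x. x \<in> Ob A \<Longrightarrow> onAr H (adj_unit X x) = adj_unit X' (onOb H x)"
    using M by (auto simp: map_of_adjunctions_def)
  note adj = adjunctionD[OF X] and adj' = adjunctionD[OF X']
  note r = is_functorD[OF adj(2)] and r' = is_functorD[OF adj'(2)]
  let ?\<epsilon> = "adj_counit X y" and ?\<epsilon>' = "adj_counit X' (onOb K y)"
  let ?z = "onOb (radj X') (onOb K y)"
  have Ry: "onOb (radj X) y \<in> Ob A" and Ky: "onOb K y \<in> Ob B'"
    using r(3) is_functorD(3)[OF K] y by auto
  have z: "?z \<in> Ob A'" using r'(3) Ky .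
  have HRy: "onOb H (onOb (radj X) y) = ?z"
    using functor_eqD(1)[OF HR y] by simp
  have KLRy: "onOb K (onOb (ladj X) (onOb (radj X) y)) = onOb (ladj X') ?z"
    using functor_eqD(1)[OF KL Ry] HRy by simp
  have K\<epsilon>: "onAr K ?\<epsilon> \<in> hom B' (onOb (ladj X') ?z) (onOb K y)"
    using is_functorD(8)[OF K adj(4)[OF y]] KLRy by simp
  \<comment> \<open>Commutation with the right adjoints and preservation of units exhibit the
    transpose of the left side as the image under \<open>H\<close> of a composite occurring in a
    triangle identity of \<open>X\<close>.\<close>
  have "Cmp A' (onAr (radj X') (onAr K ?\<epsilon>)) (adj_unit X' ?z)
      = Cmp A' (onAr H (onAr (radj X) ?\<epsilon>)) (onAr H (adj_unit X (onOb (radj X) y)))"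
    using functor_eqD(2)[OF HR, of ?\<epsilon>] adj(4)[OF y] unit[OF Ry] HRy by (simp add: hom_def)
  also have "\<dots> = onAr H (Cmp A (onAr (radj X) ?\<epsilon>) (adj_unit X (onOb (radj X) y)))"
    by (rule is_functorD(9)[OF H adj(3)[OF Ry] r(8)[OF adj(4)[OF y]], symmetric])
  also have "\<dots> = Cmp A' (onAr (radj X') ?\<epsilon>') (adj_unit X' ?z)"
    using adj(8)[OF y] adj'(8)[OF Ky] is_functorD(7)[OF H Ry] HRy by simp
  finally have eq: "Cmp A' (onAr (radj X') (onAr K ?\<epsilon>)) (adj_unit X' ?z)
      = Cmp A' (onAr (radj X') ?\<epsilon>') (adj_unit X' ?z)" .
  \<comment> \<open>Each of the two maps is recovered from its transpose; \<open>unfolded eq\<close>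
    replaces the transpose of the first by that of the second.\<close>
  show ?thesis
    by (rule trans[OF adjunction_untranspose[OF X' z Ky K\<epsilon>, symmetric, unfolded eq]
          adjunction_untranspose[OF X' z Ky adj'(4)[OF Ky]]])
qed

section \<open>Strict limits and their universal property for functors and natural
  transformations\<close>

text \<open>An elementary description, up to isomorphism, of the strict limit of the diagram with
  values \<open>S j\<close> and transition functors \<open>SF \<alpha>\<close>, which avoids quantifying over the types of
  test categories.\<close>

locale strict_limit =
  fixes J :: "('j, 'k) cat"
    and S :: "'j \<Rightarrow> ('o, 'm) cat"
    and SF :: "'k \<Rightarrow> ('o, 'm, 'o, 'm) funct"
    and E :: "('p, 'n) cat"
    and R :: "'j \<Rightarrow> ('p, 'n, 'o, 'm) funct"
  assumes cat: "category E"
    and R: "j \<in> Ob J \<Longrightarrow> is_functor E (S j) (R j)"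
    and cone: "\<alpha> \<in> Ar J \<Longrightarrow>
      functor_eq E (comp_functor (SF \<alpha>) (R (Dom J \<alpha>))) (R (Cod J \<alpha>))"
    and Ob_eqI: "\<lbrakk>x \<in> Ob E; y \<in> Ob E; \<And>j. j \<in> Ob J \<Longrightarrow> onOb (R j) x = onOb (R j) y\<rbrakk> \<Longrightarrow> x = y"
    and Ar_eqI: "\<lbrakk>f \<in> Ar E; h \<in> Ar E; \<And>j. j \<in> Ob J \<Longrightarrow> onAr (R j) f = onAr (R j) h\<rbrakk> \<Longrightarrow> f = h"
    and Ob_glue: "\<lbrakk>\<And>j. j \<in> Ob J \<Longrightarrow> xs j \<in> Ob (S j);
        \<And>\<alpha>. \<alpha> \<in> Ar J \<Longrightarrow> onOb (SF \<alpha>) (xs (Dom J \<alpha>)) = xs (Cod J \<alpha>)\<rbrakk> \<Longrightarrow>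
      \<exists>x \<in> Ob E. \<forall>j \<in> Ob J. onOb (R j) x = xs j"
    and Ar_glue: "\<lbrakk>\<And>j. j \<in> Ob J \<Longrightarrow> fs j \<in> Ar (S j);
        \<And>\<alpha>. \<alpha> \<in> Ar J \<Longrightarrow> onAr (SF \<alpha>) (fs (Dom J \<alpha>)) = fs (Cod J \<alpha>)\<rbrakk> \<Longrightarrow>
      \<exists>f \<in> Ar E. \<forall>j \<in> Ob J. onAr (R j) f = fs j"
begin

text \<open>The legs are jointly injective on objects, so the domain and codomain of
  \<open>f\<close> can be tested under them. This supplies the typing of glued arrows.\<close>

lemma hom_iff:
  assumes "f \<in> Ar E" "x \<in> Ob E" "y \<in> Ob E"
  shows "f \<in> hom E x y \<longleftrightarrow> (\<forall>j \<in> Ob J. onAr (R j) f \<in> hom (S j) (onOb (R j) x) (onOb (R j) y))"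
    (is "?l \<longleftrightarrow> ?r")
proof
  show "?l \<Longrightarrow> ?r" using is_functorD(8)[OF R] by blast
  assume r: ?r
  have "Dom E f = x" "Cod E f = y"
    using r assms category.Dom_in[OF cat] category.Cod_in[OF cat]
    by (auto intro!: Ob_eqI simp: hom_def is_functorD(5,6)[OF R, symmetric])
  then show ?l using assms(1) by (simp add: hom_def)
qed

text \<open>Existence half of the universal property: values are glued from those of the
  \<open>F j\<close>, and the functor laws hold because the legs are functors and jointly injective
  on arrows.\<close>

lemma lift_functor:
  assumes C: "category C"
    and F: "\<And>j. j \<in> Ob J \<Longrightarrow> is_functor C (S j) (F j)"
    and F_cone: "\<And>\<alpha>. \<alpha> \<in> Ar J \<Longrightarrow>
      functor_eq C (comp_functor (SF \<alpha>) (F (Dom J \<alpha>))) (F (Cod J \<alpha>))"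
  shows "\<exists>U. is_functor C E U \<and> (\<forall>j \<in> Ob J. functor_eq C (comp_functor (R j) U) (F j))"
proof -
  \<comment> \<open>The compatibility required for gluing is \<open>F_cone\<close> evaluated at
    \<open>x\<close>; afterwards \<open>metis\<close> chooses one glued object for each
    \<open>x\<close>. Arrows are treated in the same way.\<close>
  have "\<exists>y \<in> Ob E. \<forall>j \<in> Ob J. onOb (R j) y = onOb (F j) x" if "x \<in> Ob C" for x
    using that is_functorD(3)[OF F] functor_eqD(1)[OF F_cone]
    by (intro Ob_glue) auto
  then obtain uo where uo: "\<And>x. x \<in> Ob C \<Longrightarrow> uo x \<in> Ob E"
      "\<And>x j. x \<in> Ob C \<Longrightarrow> j \<in> Ob J \<Longrightarrow> onOb (R j) (uo x) = onOb (F j) x"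
    by metis
  have "\<exists>h \<in> Ar E. \<forall>j \<in> Ob J. onAr (R j) h = onAr (F j) f" if "f \<in> Ar C" for f
    using that is_functorD(4)[OF F] functor_eqD(2)[OF F_cone]
    by (intro Ar_glue) auto
  then obtain ua where ua: "\<And>f. f \<in> Ar C \<Longrightarrow> ua f \<in> Ar E"
      "\<And>f j. f \<in> Ar C \<Longrightarrow> j \<in> Ob J \<Longrightarrow> onAr (R j) (ua f) = onAr (F j) f"
    by metis
  have ua_hom: "ua f \<in> hom E (uo x) (uo y)" if f: "f \<in> hom C x y" for f x y
  proof -
    have "f \<in> Ar C" "x \<in> Ob C" "y \<in> Ob C"
      using f category.Dom_in[OF C] category.Cod_in[OF C] by (auto simp: hom_def)
    then show ?thesis
      using is_functorD(8)[OF F f] uo ua by (simp add: hom_iff)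
  qed
  let ?U = "\<lparr>onOb = uo, onAr = ua\<rparr>"
  have "is_functor C E ?U"
  proof (rule is_functorI[OF C cat], simp_all add: uo(1))
    fix f assume "f \<in> Ar C"
    then show "ua f \<in> hom E (uo (Dom C f)) (uo (Cod C f))"
      by (intro ua_hom) (simp add: hom_def)
  next
    fix x assume x: "x \<in> Ob C"
    have ix: "Ide C x \<in> Ar C" using category.Ide_in[OF C x] by (simp add: hom_def)
    \<comment> \<open>Under \<open>R j\<close> both sides become the identity on
      \<open>onOb (F j) x\<close>.\<close>
    show "ua (Ide C x) = Ide E (uo x)"
    proof (rule Ar_eqI)
      show "Ide E (uo x) \<in> Ar E" using category.Ide_in[OF cat uo(1)[OF x]] by (simp add: hom_def)
      fix j assume "j \<in> Ob J"
      then show "onAr (R j) (ua (Ide C x)) = onAr (R j) (Ide E (uo x))"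
        using x ix by (simp add: ua uo is_functorD(7)[OF F] is_functorD(7)[OF R])
    qed (rule ua(1)[OF ix])
  next
    fix f h assume f: "f \<in> Ar C" and h: "h \<in> Ar C" and eq: "Cod C f = Dom C h"
    have f': "f \<in> hom C (Dom C f) (Cod C f)" and h': "h \<in> hom C (Cod C f) (Cod C h)"
      using f h eq by (auto simp: hom_def)
    have hf: "Cmp C h f \<in> Ar C" using category.Cmp_in[OF C f' h'] by (simp add: hom_def)
    show "ua (Cmp C h f) = Cmp E (ua h) (ua f)"
    proof (rule Ar_eqI)
      show "Cmp E (ua h) (ua f) \<in> Ar E"
        using category.Cmp_in[OF cat ua_hom[OF f'] ua_hom[OF h']] by (simp add: hom_def)
      fix j assume j: "j \<in> Ob J"
      show "onAr (R j) (ua (Cmp C h f)) = onAr (R j) (Cmp E (ua h) (ua f))"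
        using is_functorD(9)[OF R[OF j] ua_hom[OF f'] ua_hom[OF h']]
          is_functorD(9)[OF F[OF j] f' h'] ua(2)[OF _ j] f h hf by simp
    qed (rule ua(1)[OF hf])
  qed
  moreover have "\<forall>j \<in> Ob J. functor_eq C (comp_functor (R j) ?U) (F j)"
    by (simp add: functor_eq_def uo ua)
  ultimately show ?thesis by blast
qed

text \<open>Uniqueness half of the universal property, from joint injectivity of the legs on objects
  and on arrows.\<close>

lemma lift_functor_unique:
  assumes U: "is_functor C E U" and V: "is_functor C E V"
    and "\<And>j. j \<in> Ob J \<Longrightarrow> functor_eq C (comp_functor (R j) U) (F j)"
    and "\<And>j. j \<in> Ob J \<Longrightarrow> functor_eq C (comp_functor (R j) V) (F j)"
  shows "functor_eq C U V"
  using assms is_functorD(3,4)[OF U] is_functorD(3,4)[OF V]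
  by (auto simp: functor_eq_def intro!: Ob_eqI Ar_eqI)

text \<open>Two-dimensional part of the universal property: the components glue by
  \<open>compat\<close>, and naturality is an equation between arrows of \<open>E\<close>, which can
  be checked under the legs.\<close>

lemma lift_nat_trans:
  assumes F: "is_functor C E F" and G: "is_functor C E G"
    and hom: "\<And>j x. j \<in> Ob J \<Longrightarrow> x \<in> Ob C \<Longrightarrow>
      \<tau> j x \<in> hom (S j) (onOb (R j) (onOb F x)) (onOb (R j) (onOb G x))"
    and nat: "\<And>j x y f. j \<in> Ob J \<Longrightarrow> f \<in> hom C x y \<Longrightarrow>
      Cmp (S j) (onAr (R j) (onAr G f)) (\<tau> j x) = Cmp (S j) (\<tau> j y) (onAr (R j) (onAr F f))"
    and compat: "\<And>\<alpha> x. \<alpha> \<in> Ar J \<Longrightarrow> x \<in> Ob C \<Longrightarrow>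
      onAr (SF \<alpha>) (\<tau> (Dom J \<alpha>) x) = \<tau> (Cod J \<alpha>) x"
  shows "\<exists>\<sigma>. nat_trans C E F G \<sigma> \<and> (\<forall>j \<in> Ob J. \<forall>x \<in> Ob C. onAr (R j) (\<sigma> x) = \<tau> j x)"
proof -
  note C = is_functorD(1)[OF F]
  have "\<exists>h \<in> Ar E. \<forall>j \<in> Ob J. onAr (R j) h = \<tau> j x" if "x \<in> Ob C" for x
    using that hom compat by (intro Ar_glue) (auto simp: hom_def)
  then obtain \<sigma> where \<sigma>: "\<And>x. x \<in> Ob C \<Longrightarrow> \<sigma> x \<in> Ar E"
      "\<And>x j. x \<in> Ob C \<Longrightarrow> j \<in> Ob J \<Longrightarrow> onAr (R j) (\<sigma> x) = \<tau> j x"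
    by metis
  have \<sigma>_hom: "\<sigma> x \<in> hom E (onOb F x) (onOb G x)" if "x \<in> Ob C" for x
    using that hom \<sigma> is_functorD(3)[OF F] is_functorD(3)[OF G] by (simp add: hom_iff)
  have "Cmp E (onAr G f) (\<sigma> (Dom C f)) = Cmp E (\<sigma> (Cod C f)) (onAr F f)" if f: "f \<in> Ar C" for f
  proof -
    have f': "f \<in> hom C (Dom C f) (Cod C f)" using f by (simp add: hom_def)
    have x: "Dom C f \<in> Ob C" and y: "Cod C f \<in> Ob C"
      using category.Dom_in[OF C f] category.Cod_in[OF C f] .
    note Ff = is_functorD(8)[OF F f'] and Gf = is_functorD(8)[OF G f']
    show ?thesis
    proof (rule Ar_eqI)
      show "Cmp E (onAr G f) (\<sigma> (Dom C f)) \<in> Ar E"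
        using category.Cmp_in[OF cat \<sigma>_hom[OF x] Gf] by (simp add: hom_def)
      show "Cmp E (\<sigma> (Cod C f)) (onAr F f) \<in> Ar E"
        using category.Cmp_in[OF cat Ff \<sigma>_hom[OF y]] by (simp add: hom_def)
      fix j assume j: "j \<in> Ob J"
      show "onAr (R j) (Cmp E (onAr G f) (\<sigma> (Dom C f)))
          = onAr (R j) (Cmp E (\<sigma> (Cod C f)) (onAr F f))"
        using is_functorD(9)[OF R[OF j] \<sigma>_hom[OF x] Gf]
          is_functorD(9)[OF R[OF j] Ff \<sigma>_hom[OF y]] nat[OF j f'] \<sigma>(2) x y j by simp
    qed
  qed
  then have "nat_trans C E F G \<sigma>"
    using F G \<sigma>_hom by (simp add: nat_trans_def)
  then show ?thesis using \<sigma>(2) by blast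
qed

end

section \<open>Lifting adjunctions to strict limits\<close>

text \<open>Right adjoint, unit and counit are lifted one after the other, each being a compatible
  family because the transition functors preserve it. \<open>G\<close> is prescribed rather than
  lifted, so that the resulting left adjoint is exactly this functor.\<close>

lemma lift_adjunction:
  assumes J: "category J"
    and A: "strict_limit J SA FA A RA" and B: "strict_limit J SB FB B RB"
    and X: "\<And>j. j \<in> Ob J \<Longrightarrow> adjunction (SA j) (SB j) (X j)"
    and trans: "\<And>\<alpha>. \<alpha> \<in> Ar J \<Longrightarrow>
      map_of_adjunctions (SA (Dom J \<alpha>)) (SB (Dom J \<alpha>)) (X (Dom J \<alpha>))
        (SA (Cod J \<alpha>)) (SB (Cod J \<alpha>)) (X (Cod J \<alpha>)) (FA \<alpha>) (FB \<alpha>)"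
    and G: "is_functor A B G"
    and G_legs: "\<And>j. j \<in> Ob J \<Longrightarrow>
      functor_eq A (comp_functor (RB j) G) (comp_functor (ladj (X j)) (RA j))"
  shows "\<exists>Y. ladj Y = G \<and> adjunction A B Y \<and>
    (\<forall>j \<in> Ob J. map_of_adjunctions A B Y (SA j) (SB j) (X j) (RA j) (RB j))"
proof -
  interpret A: strict_limit J SA FA A RA by fact
  interpret B: strict_limit J SB FB B RB by fact
  note adj = adjunctionD[OF X]
  have ObJ: "Dom J \<alpha> \<in> Ob J" "Cod J \<alpha> \<in> Ob J" if "\<alpha> \<in> Ar J" for \<alpha>
    using category.Dom_in[OF J that] category.Cod_in[OF J that] .
  have RA_Ob: "onOb (RA j) x \<in> Ob (SA j)" if "j \<in> Ob J" "x \<in> Ob A" for j x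
    using is_functorD(3)[OF A.R] that by blast
  have RB_Ob: "onOb (RB j) y \<in> Ob (SB j)" if "j \<in> Ob J" "y \<in> Ob B" for j y
    using is_functorD(3)[OF B.R] that by blast
  have RB_Ar: "onAr (RB j) f \<in> Ar (SB j)" if "j \<in> Ob J" "f \<in> Ar B" for j f
    using is_functorD(4)[OF B.R] that by blast
  \<comment> \<open>The leg of \<open>U\<close> at \<open>j\<close> is to be restriction followed by
    the right adjoint of \<open>X j\<close>. The cone condition combines commutation of the
    transition functors with right adjoints and the cone of \<open>B\<close>.\<close>
  have "\<exists>U. is_functor B A U \<and>
      (\<forall>j \<in> Ob J. functor_eq B (comp_functor (RA j) U) (comp_functor (radj (X j)) (RB j)))"
  proof (rule A.lift_functor[OF B.cat])
    fix j assume "j \<in> Ob J"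
    then show "is_functor B (SA j) (comp_functor (radj (X j)) (RB j))"
      using is_functor_comp[OF B.R adj(2)] by blast
  next
    fix \<alpha> assume \<alpha>: "\<alpha> \<in> Ar J"
    have "functor_eq (SB (Dom J \<alpha>)) (comp_functor (FA \<alpha>) (radj (X (Dom J \<alpha>))))
        (comp_functor (radj (X (Cod J \<alpha>))) (FB \<alpha>))"
      using trans[OF \<alpha>] by (simp add: map_of_adjunctions_def)
    then show "functor_eq B (comp_functor (FA \<alpha>) (comp_functor (radj (X (Dom J \<alpha>))) (RB (Dom J \<alpha>))))
        (comp_functor (radj (X (Cod J \<alpha>))) (RB (Cod J \<alpha>)))"
      using B.cone[OF \<alpha>] RB_Ob RB_Ar ObJ[OF \<alpha>] by (simp add: functor_eq_def)
  qed
  then obtain U where U: "is_functor B A U"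
    and U_legs: "\<And>j. j \<in> Ob J \<Longrightarrow>
      functor_eq B (comp_functor (RA j) U) (comp_functor (radj (X j)) (RB j))"
    by blast
  \<comment> \<open>As rewrite rules, the leg equations push a leg through \<open>G\<close> or
    \<open>U\<close> into the adjunction \<open>X j\<close>.\<close>
  have G_Ob: "onOb (RB j) (onOb G x) = onOb (ladj (X j)) (onOb (RA j) x)"
    if "j \<in> Ob J" "x \<in> Ob A" for j x
    using functor_eqD(1)[OF G_legs] that by simp
  have G_Ar: "onAr (RB j) (onAr G f) = onAr (ladj (X j)) (onAr (RA j) f)"
    if "j \<in> Ob J" "f \<in> Ar A" for j f
    using functor_eqD(2)[OF G_legs] that by simp
  have U_Ob: "onOb (RA j) (onOb U y) = onOb (radj (X j)) (onOb (RB j) y)"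
    if "j \<in> Ob J" "y \<in> Ob B" for j y
    using functor_eqD(1)[OF U_legs] that by simp
  have U_Ar: "onAr (RA j) (onAr U f) = onAr (radj (X j)) (onAr (RB j) f)"
    if "j \<in> Ob J" "f \<in> Ar B" for j f
    using functor_eqD(2)[OF U_legs] that by simp
  note in_B = is_functorD(3,4)[OF G] and in_A = is_functorD(3,4)[OF U]
  \<comment> \<open>The components are the units of \<open>X j\<close> at the restricted objects.
    Their targets fit since the legs turn \<open>U\<close> after \<open>G\<close> into the right
    adjoint after the left adjoint of \<open>X j\<close>.\<close>
  have "\<exists>\<eta>. nat_trans A A id_functor (comp_functor U G) \<eta> \<and>
      (\<forall>j \<in> Ob J. \<forall>x \<in> Ob A. onAr (RA j) (\<eta> x) = adj_unit (X j) (onOb (RA j) x))"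
  proof (rule A.lift_nat_trans[OF is_functor_id[OF A.cat] is_functor_comp[OF G U]])
    fix j x assume "j \<in> Ob J" "x \<in> Ob A"
    then show "adj_unit (X j) (onOb (RA j) x) \<in> hom (SA j)
        (onOb (RA j) (onOb id_functor x)) (onOb (RA j) (onOb (comp_functor U G) x))"
      using adj(3)[OF _ RA_Ob] by (simp add: U_Ob G_Ob in_B)
  next
    fix j x y f assume j: "j \<in> Ob J" and f: "f \<in> hom A x y"
    have "f \<in> Ar A" using f by (simp add: hom_def)
    then show "Cmp (SA j) (onAr (RA j) (onAr (comp_functor U G) f)) (adj_unit (X j) (onOb (RA j) x))
        = Cmp (SA j) (adj_unit (X j) (onOb (RA j) y)) (onAr (RA j) (onAr id_functor f))"
      using adj(5)[OF j is_functorD(8)[OF A.R[OF j] f]] j by (simp add: U_Ar G_Ar in_B)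
  next
    fix \<alpha> x assume \<alpha>: "\<alpha> \<in> Ar J" and x: "x \<in> Ob A"
    show "onAr (FA \<alpha>) (adj_unit (X (Dom J \<alpha>)) (onOb (RA (Dom J \<alpha>)) x))
        = adj_unit (X (Cod J \<alpha>)) (onOb (RA (Cod J \<alpha>)) x)"
      using trans[OF \<alpha>] RA_Ob[OF ObJ(1)[OF \<alpha>] x] functor_eqD(1)[OF A.cone[OF \<alpha>] x]
      by (simp add: map_of_adjunctions_def)
  qed
  then obtain \<eta> where \<eta>: "nat_trans A A id_functor (comp_functor U G) \<eta>"
    and \<eta>_legs: "\<And>j x. j \<in> Ob J \<Longrightarrow> x \<in> Ob A \<Longrightarrow>
      onAr (RA j) (\<eta> x) = adj_unit (X j) (onOb (RA j) x)"
    by blast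
  have "\<exists>\<epsilon>. nat_trans B B (comp_functor G U) id_functor \<epsilon> \<and>
      (\<forall>j \<in> Ob J. \<forall>y \<in> Ob B. onAr (RB j) (\<epsilon> y) = adj_counit (X j) (onOb (RB j) y))"
  proof (rule B.lift_nat_trans[OF is_functor_comp[OF U G] is_functor_id[OF B.cat]])
    fix j y assume "j \<in> Ob J" "y \<in> Ob B"
    then show "adj_counit (X j) (onOb (RB j) y) \<in> hom (SB j)
        (onOb (RB j) (onOb (comp_functor G U) y)) (onOb (RB j) (onOb id_functor y))"
      using adj(4)[OF _ RB_Ob] by (simp add: U_Ob G_Ob in_A)
  next
    fix j x y f assume j: "j \<in> Ob J" and f: "f \<in> hom B x y"
    have "f \<in> Ar B" using f by (simp add: hom_def)
    then show "Cmp (SB j) (onAr (RB j) (onAr id_functor f)) (adj_counit (X j) (onOb (RB j) x))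
        = Cmp (SB j) (adj_counit (X j) (onOb (RB j) y)) (onAr (RB j) (onAr (comp_functor G U) f))"
      using adj(6)[OF j is_functorD(8)[OF B.R[OF j] f]] j by (simp add: U_Ar G_Ar in_A)
  next
    \<comment> \<open>The definition of a map of adjunctions records preservation of units; for
      counits its consequence \<open>map_of_adjunctions_counit\<close> is used.\<close>
    fix \<alpha> y assume \<alpha>: "\<alpha> \<in> Ar J" and y: "y \<in> Ob B"
    show "onAr (FB \<alpha>) (adj_counit (X (Dom J \<alpha>)) (onOb (RB (Dom J \<alpha>)) y))
        = adj_counit (X (Cod J \<alpha>)) (onOb (RB (Cod J \<alpha>)) y)"
      using map_of_adjunctions_counit[OF trans[OF \<alpha>] RB_Ob[OF ObJ(1)[OF \<alpha>] y]]
        functor_eqD(1)[OF B.cone[OF \<alpha>] y] by simp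
  qed
  then obtain \<epsilon> where \<epsilon>: "nat_trans B B (comp_functor G U) id_functor \<epsilon>"
    and \<epsilon>_legs: "\<And>j y. j \<in> Ob J \<Longrightarrow> y \<in> Ob B \<Longrightarrow>
      onAr (RB j) (\<epsilon> y) = adj_counit (X j) (onOb (RB j) y)"
    by blast
  \<comment> \<open>Both triangle identities are checked under the legs, where they become the
    triangle identities of \<open>X j\<close> at the restricted object.\<close>
  have tri_G: "Cmp B (\<epsilon> (onOb G x)) (onAr G (\<eta> x)) = Ide B (onOb G x)" if x: "x \<in> Ob A" for x
  proof (rule B.Ar_eqI)
    have Gx: "onOb G x \<in> Ob B" using in_B(1)[OF x] .
    have \<eta>x: "\<eta> x \<in> Ar A" using nat_transD(3)[OF \<eta> x] by (simp add: hom_def)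
    have 1: "onAr G (\<eta> x) \<in> hom B (onOb G x) (onOb G (onOb U (onOb G x)))"
      using is_functorD(8)[OF G nat_transD(3)[OF \<eta> x]] by simp
    have 2: "\<epsilon> (onOb G x) \<in> hom B (onOb G (onOb U (onOb G x))) (onOb G x)"
      using nat_transD(3)[OF \<epsilon> Gx] by simp
    show "Cmp B (\<epsilon> (onOb G x)) (onAr G (\<eta> x)) \<in> Ar B"
      using category.Cmp_in[OF B.cat 1 2] by (simp add: hom_def)
    show "Ide B (onOb G x) \<in> Ar B"
      using category.Ide_in[OF B.cat Gx] by (simp add: hom_def)
    fix j assume j: "j \<in> Ob J"
    show "onAr (RB j) (Cmp B (\<epsilon> (onOb G x)) (onAr G (\<eta> x))) = onAr (RB j) (Ide B (onOb G x))"
      using is_functorD(9)[OF B.R[OF j] 1 2] adj(7)[OF j RA_Ob[OF j x]]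
        is_functorD(7)[OF B.R[OF j] Gx] by (simp add: \<epsilon>_legs \<eta>_legs G_Ob G_Ar j x Gx \<eta>x)
  qed
  have tri_U: "Cmp A (onAr U (\<epsilon> y)) (\<eta> (onOb U y)) = Ide A (onOb U y)" if y: "y \<in> Ob B" for y
  proof (rule A.Ar_eqI)
    have Uy: "onOb U y \<in> Ob A" using in_A(1)[OF y] .
    have \<epsilon>y: "\<epsilon> y \<in> Ar B" using nat_transD(3)[OF \<epsilon> y] by (simp add: hom_def)
    have 1: "\<eta> (onOb U y) \<in> hom A (onOb U y) (onOb U (onOb G (onOb U y)))"
      using nat_transD(3)[OF \<eta> Uy] by simp
    have 2: "onAr U (\<epsilon> y) \<in> hom A (onOb U (onOb G (onOb U y))) (onOb U y)"
      using is_functorD(8)[OF U nat_transD(3)[OF \<epsilon> y]] by simp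
    show "Cmp A (onAr U (\<epsilon> y)) (\<eta> (onOb U y)) \<in> Ar A"
      using category.Cmp_in[OF A.cat 1 2] by (simp add: hom_def)
    show "Ide A (onOb U y) \<in> Ar A"
      using category.Ide_in[OF A.cat Uy] by (simp add: hom_def)
    fix j assume j: "j \<in> Ob J"
    show "onAr (RA j) (Cmp A (onAr U (\<epsilon> y)) (\<eta> (onOb U y))) = onAr (RA j) (Ide A (onOb U y))"
      using is_functorD(9)[OF A.R[OF j] 1 2] adj(8)[OF j RB_Ob[OF j y]]
        is_functorD(7)[OF A.R[OF j] Uy] by (simp add: \<epsilon>_legs \<eta>_legs U_Ob U_Ar j y Uy \<epsilon>y)
  qed
  let ?Y = "\<lparr>ladj = G, radj = U, adj_unit = \<eta>, adj_counit = \<epsilon>\<rparr>"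
  have "adjunction A B ?Y"
    using G U \<eta> \<epsilon> tri_G tri_U by (simp add: adjunction_def)
  \<comment> \<open>That the legs form a map of adjunctions is exactly the leg equations for
    \<open>G\<close>, \<open>U\<close> and \<open>\<eta>\<close>.\<close>
  then have "ladj ?Y = G \<and> adjunction A B ?Y \<and>
      (\<forall>j \<in> Ob J. map_of_adjunctions A B ?Y (SA j) (SB j) (X j) (RA j) (RB j))"
    by (simp add: map_of_adjunctions_def X A.R B.R G_legs U_legs \<eta>_legs)
  then show ?thesis by blast
qed

section \<open>Slices of a strict limit\<close>

text \<open>Arrows of \<open>limit_cat\<close> are extensional, so a family has to be cut down to
  \<open>Ob J\<close>. Compatibility survives because both ends of an arrow of \<open>J\<close> lie
  in \<open>Ob J\<close>.\<close>

lemma restrict_in_limit_Ar: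
  assumes "category J"
    and "\<And>j. j \<in> Ob J \<Longrightarrow> f j \<in> Ar (D j)"
    and "\<And>\<alpha>. \<alpha> \<in> Ar J \<Longrightarrow> onAr (T \<alpha>) (f (Dom J \<alpha>)) = f (Cod J \<alpha>)"
  shows "restrict f (Ob J) \<in> Ar (limit_cat J D T)"
  using assms category.Dom_in[OF assms(1)] category.Cod_in[OF assms(1)]
  by (auto simp: limit_cat_def)

text \<open>The type of objects of \<open>leg j\<close> does not occur in the type of
  \<open>slice_functor (leg j)\<close>, so different occurrences of this term may be at different instances;
  \<open>slice_leg j\<close> identifies them.\<close>

definition slice_leg ::
  "'j \<Rightarrow> ('j \<Rightarrow> 'm, ('j \<Rightarrow> 'm) \<times> ('j \<Rightarrow> 'm) \<times> ('j \<Rightarrow> 'm), 'm, 'm \<times> 'm \<times> 'm) funct" where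
  "slice_leg j = \<lparr>onOb = (\<lambda>f. f j), onAr = (\<lambda>(f, h, f'). (f j, h j, f' j))\<rparr>"

lemma slice_functor_leg: "slice_functor (leg j) = slice_leg j"
  by (auto simp: slice_functor_def slice_leg_def)

text \<open>A slice object is an arrow with prescribed codomain, and a slice arrow is three arrows
  subject to equations, all of which hold in \<open>limit_cat\<close> when they hold in every
  component. Hence compatible families in the slices glue as families of arrows do.\<close>

lemma strict_limit_slice:
  assumes diagram: "diagram J D T" and a: "a \<in> Ob (limit_cat J D T)"
  shows "strict_limit J (\<lambda>j. slice (D j) (a j)) (\<lambda>\<alpha>. slice_functor (T \<alpha>))
    (slice (limit_cat J D T) a) slice_leg"
proof -
  let ?L = "limit_cat J D T"
  have J: "category J" using diagram by (simp add: diagram_def)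
  have a_ext: "a \<in> extensional (Ob J)" using a by (auto simp: limit_cat_def PiE_iff)
  \<comment> \<open>Agreement on \<open>Ob J\<close> suffices, since both families are
    \<open>undefined\<close> elsewhere.\<close>
  have Cod_a: "Cod ?L (restrict f (Ob J)) = a" if "\<And>j. j \<in> Ob J \<Longrightarrow> Cod (D j) (f j) = a j" for f
    using a_ext that by (intro extensionalityI[of _ "Ob J"]) (auto simp: limit_cat_def)
  have Ar_eq: "f = h" if "f \<in> Ar ?L" "h \<in> Ar ?L" "\<And>j. j \<in> Ob J \<Longrightarrow> f j = h j" for f h
    using that by (intro extensionalityI[of _ "Ob J"]) (auto simp: limit_cat_def PiE_iff)
  show ?thesis
  proof (rule strict_limit.intro)
    show "category (slice ?L a)" by (rule category_slice[OF category_limit_cat[OF diagram]])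
  next
    fix j assume "j \<in> Ob J"
    then show "is_functor (slice ?L a) (slice (D j) (a j)) (slice_leg j)"
      using is_functor_slice_functor[OF limit_cat_cone(1)[OF diagram], of j a] by (simp add: slice_functor_leg)
  next
    fix \<alpha> assume "\<alpha> \<in> Ar J"
    then show "functor_eq (slice ?L a)
        (comp_functor (slice_functor (T \<alpha>)) (slice_leg (Dom J \<alpha>)))
        (slice_leg (Cod J \<alpha>))"
      using limit_cat_cone(2)[OF diagram]
      by (auto simp: functor_eq_def slice_def slice_functor_def slice_leg_def hom_def)
  next
    fix x y assume "x \<in> Ob (slice ?L a)" "y \<in> Ob (slice ?L a)"
      "\<And>j. j \<in> Ob J \<Longrightarrow> onOb (slice_leg j) x = onOb (slice_leg j) y"
    then show "x = y" by (intro Ar_eq) (auto simp: slice_def slice_leg_def)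
  next
    fix t u assume "t \<in> Ar (slice ?L a)" "u \<in> Ar (slice ?L a)"
      "\<And>j. j \<in> Ob J \<Longrightarrow> onAr (slice_leg j) t = onAr (slice_leg j) u"
    then show "t = u"
      by (cases t, cases u) (auto simp: slice_def slice_leg_def hom_def intro!: Ar_eq)
  next
    fix xs assume xs: "\<And>j. j \<in> Ob J \<Longrightarrow> xs j \<in> Ob (slice (D j) (a j))"
      and "\<And>\<alpha>. \<alpha> \<in> Ar J \<Longrightarrow> onOb (slice_functor (T \<alpha>)) (xs (Dom J \<alpha>)) = xs (Cod J \<alpha>)"
    then have "restrict xs (Ob J) \<in> Ar ?L"
      by (intro restrict_in_limit_Ar[OF J]) (auto simp: slice_def slice_functor_def)
    then have "restrict xs (Ob J) \<in> Ob (slice ?L a)"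
      using xs Cod_a[of xs] by (simp add: slice_def)
    then show "\<exists>x \<in> Ob (slice ?L a). \<forall>j \<in> Ob J. onOb (slice_leg j) x = xs j"
      by (rule rev_bexI) (simp add: slice_leg_def)
  next
    fix ts assume ts: "\<And>j. j \<in> Ob J \<Longrightarrow> ts j \<in> Ar (slice (D j) (a j))"
      and compat: "\<And>\<alpha>. \<alpha> \<in> Ar J \<Longrightarrow> onAr (slice_functor (T \<alpha>)) (ts (Dom J \<alpha>)) = ts (Cod J \<alpha>)"
    \<comment> \<open>A family of commuting triangles is split into three families of arrows; each
      is compatible because \<open>slice_functor (T \<alpha>)\<close> acts on triples entry by
      entry.\<close>
    define f h f' where "f = fst \<circ> ts" and "h = fst \<circ> snd \<circ> ts" and "f' = snd \<circ> snd \<circ> ts"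
    have ts_eq: "ts j = (f j, h j, f' j)" for j by (simp add: f_def h_def f'_def)
    have props: "f j \<in> Ar (D j)" "h j \<in> Ar (D j)" "f' j \<in> Ar (D j)"
        "Cod (D j) (f j) = a j" "Cod (D j) (f' j) = a j" "Cmp (D j) (f' j) (h j) = f j"
        "Dom (D j) (h j) = Dom (D j) (f j)" "Cod (D j) (h j) = Dom (D j) (f' j)"
      if "j \<in> Ob J" for j
      using ts[OF that] by (auto simp: ts_eq slice_def hom_def)
    have "onAr (T \<alpha>) (f (Dom J \<alpha>)) = f (Cod J \<alpha>)" "onAr (T \<alpha>) (h (Dom J \<alpha>)) = h (Cod J \<alpha>)"
        "onAr (T \<alpha>) (f' (Dom J \<alpha>)) = f' (Cod J \<alpha>)" if "\<alpha> \<in> Ar J" for \<alpha>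
      using compat[OF that] by (auto simp: ts_eq slice_functor_def)
    then have "restrict f (Ob J) \<in> Ar ?L" "restrict h (Ob J) \<in> Ar ?L" "restrict f' (Ob J) \<in> Ar ?L"
      using props by (auto intro!: restrict_in_limit_Ar[OF J])
    moreover have "Dom ?L (restrict h (Ob J)) = Dom ?L (restrict f (Ob J))"
        "Cod ?L (restrict h (Ob J)) = Dom ?L (restrict f' (Ob J))"
        "Cmp ?L (restrict f' (Ob J)) (restrict h (Ob J)) = restrict f (Ob J)"
      using props by (auto simp: limit_cat_def)
    ultimately have "(restrict f (Ob J), restrict h (Ob J), restrict f' (Ob J)) \<in> Ar (slice ?L a)"
      using props Cod_a[of f] Cod_a[of f'] by (simp add: slice_def hom_def)
    then show "\<exists>t \<in> Ar (slice ?L a). \<forall>j \<in> Ob J. onAr (slice_leg j) t = ts j"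
      by (rule rev_bexI) (simp add: slice_leg_def ts_eq)
  qed
qed

section \<open>The right adjoint to pullback along a map of the limit\<close>

theorem corollary3p5:
  fixes J :: "('j, 'k) cat"
    and D :: "'j \<Rightarrow> ('o, 'm) cat"
    and T :: "'k \<Rightarrow> ('o, 'm, 'o, 'm) funct"
    and a b :: "'j \<Rightarrow> 'o"
    and g :: "'j \<Rightarrow> 'm"
    and X :: "'j \<Rightarrow> ('m, 'm \<times> 'm \<times> 'm, 'm, 'm \<times> 'm \<times> 'm) adj"
    and G :: "('j \<Rightarrow> 'm, ('j \<Rightarrow> 'm) \<times> ('j \<Rightarrow> 'm) \<times> ('j \<Rightarrow> 'm),
               'j \<Rightarrow> 'm, ('j \<Rightarrow> 'm) \<times> ('j \<Rightarrow> 'm) \<times> ('j \<Rightarrow> 'm)) funct"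
    and L :: "('j \<Rightarrow> 'o, 'j \<Rightarrow> 'm) cat"
  assumes diagram: "diagram J D T"
    and L: "L = limit_cat J D T"
    and g: "g \<in> hom L b a"
    and powerful_legs: "\<And>j. j \<in> Ob J \<Longrightarrow> powerful_with (D j) (onAr (leg j) g) (X j)"
    and pullback: "is_pullback_functor L g G"
    and pullback_legs: "\<And>j. j \<in> Ob J \<Longrightarrow>
      functor_eq (slice L a)
        (comp_functor (slice_functor (leg j)) G)
        (comp_functor (ladj (X j)) (slice_functor (leg j)))"
    and transition: "\<And>\<alpha> j j'. j \<in> Ob J \<Longrightarrow> j' \<in> Ob J \<Longrightarrow> \<alpha> \<in> hom J j j' \<Longrightarrow>
      map_of_adjunctions
        (slice (D j) (onOb (leg j) a)) (slice (D j) (onOb (leg j) b)) (X j)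
        (slice (D j') (onOb (leg j') a)) (slice (D j') (onOb (leg j') b)) (X j')
        (slice_functor (T \<alpha>)) (slice_functor (T \<alpha>))"
  shows "powerful L g \<and>
    (\<exists>Y. ladj Y = G \<and> powerful_with L g Y \<and>
      (\<forall>j \<in> Ob J. functor_eq (slice L b)
         (comp_functor (slice_functor (leg j)) (radj Y))
         (comp_functor (radj (X j)) (slice_functor (leg j)))) \<and>
      (\<forall>Q. is_functor (slice L b) (slice L a) Q \<and>
         (\<forall>j \<in> Ob J. functor_eq (slice L b)
            (comp_functor (slice_functor (leg j)) Q)
            (comp_functor (radj (X j)) (slice_functor (leg j)))) \<longrightarrow>
         functor_eq (slice L b) Q (radj Y)) \<and>
      (\<forall>j \<in> Ob J. map_of_adjunctions
         (slice L a) (slice L b) Y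
         (slice (D j) (onOb (leg j) a)) (slice (D j) (onOb (leg j) b)) (X j)
         (slice_functor (leg j)) (slice_functor (leg j))))"
proof -
  have J: "category J" using diagram by (simp add: diagram_def)
  have catL: "category L" using category_limit_cat[OF diagram] L by simp
  have gAr: "g \<in> Ar L" and Dom_g: "Dom L g = b" and Cod_g: "Cod L g = a"
    using g by (auto simp: hom_def)
  \<comment> \<open>This identifies the slices over the ends of \<open>g j\<close>, in which
    \<open>powerful_legs\<close> is phrased, with those over \<open>a j\<close> and
    \<open>b j\<close>.\<close>
  have Dom_gj: "Dom (D j) (g j) = b j" and Cod_gj: "Cod (D j) (g j) = a j" if "j \<in> Ob J" for j
    using that Dom_g Cod_g by (auto simp: L limit_cat_def)
  have aL: "a \<in> Ob L" and bL: "b \<in> Ob L"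
    using category.Dom_in[OF catL gAr] category.Cod_in[OF catL gAr] Dom_g Cod_g by auto
  note A = strict_limit_slice[OF diagram aL[unfolded L], folded L]
    and B = strict_limit_slice[OF diagram bL[unfolded L], folded L]
  \<comment> \<open>Adjunctions are lifted to the slices over \<open>a\<close> and \<open>b\<close>,
    with the given pullback functor as the prescribed left adjoint.\<close>
  have "\<exists>Y. ladj Y = G \<and> adjunction (slice L a) (slice L b) Y \<and>
    (\<forall>j \<in> Ob J. map_of_adjunctions (slice L a) (slice L b) Y
      (slice (D j) (a j)) (slice (D j) (b j)) (X j) (slice_leg j) (slice_leg j))"
  proof (rule lift_adjunction[OF J A B])
    fix j assume "j \<in> Ob J"
    then show "adjunction (slice (D j) (a j)) (slice (D j) (b j)) (X j)"
      using powerful_legs[of j] by (simp add: powerful_with_def Dom_gj Cod_gj)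
  next
    fix \<alpha> assume "\<alpha> \<in> Ar J"
    then show "map_of_adjunctions (slice (D (Dom J \<alpha>)) (a (Dom J \<alpha>)))
        (slice (D (Dom J \<alpha>)) (b (Dom J \<alpha>))) (X (Dom J \<alpha>))
        (slice (D (Cod J \<alpha>)) (a (Cod J \<alpha>))) (slice (D (Cod J \<alpha>)) (b (Cod J \<alpha>))) (X (Cod J \<alpha>))
        (slice_functor (T \<alpha>)) (slice_functor (T \<alpha>))"
      using transition[of "Dom J \<alpha>" "Cod J \<alpha>" \<alpha>] category.Dom_in[OF J] category.Cod_in[OF J]
      by (simp add: hom_def)
  next
    show "is_functor (slice L a) (slice L b) G"
      using pullback by (simp add: is_pullback_functor_def Dom_g Cod_g)
  qed (rule pullback_legs[unfolded slice_functor_leg])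
  then obtain Y where Y: "ladj Y = G" "adjunction (slice L a) (slice L b) Y"
    and maps: "\<And>j. j \<in> Ob J \<Longrightarrow> map_of_adjunctions (slice L a) (slice L b) Y
      (slice (D j) (a j)) (slice (D j) (b j)) (X j) (slice_leg j) (slice_leg j)"
    by blast
  \<comment> \<open>The pullback functor supplies the squares: \<open>onOb G f\<close> together with
    its witnessing projection is a pullback of \<open>f\<close> along \<open>g\<close>.\<close>
  have "has_pullbacks_along L g"
    using pullback
    by (auto simp: is_pullback_functor_def has_pullbacks_along_def slice_def)
  then have pw: "powerful_with L g Y"
    using Y pullback by (simp add: powerful_with_def Dom_g Cod_g)
  have legs: "functor_eq (slice L b) (comp_functor (slice_leg j) (radj Y))
      (comp_functor (radj (X j)) (slice_leg j))" if "j \<in> Ob J" for j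
    using maps[OF that] by (simp add: map_of_adjunctions_def)
  \<comment> \<open>\<open>Q\<close> and \<open>radj Y\<close> have the same legs into the slices
    over the \<open>a j\<close>, so uniqueness of lifts to \<open>slice L a\<close> applies.\<close>
  have "functor_eq (slice L b) Q (radj Y)" if "is_functor (slice L b) (slice L a) Q"
    and "\<forall>j \<in> Ob J. functor_eq (slice L b) (comp_functor (slice_leg j) Q)
      (comp_functor (radj (X j)) (slice_leg j))" for Q
    using strict_limit.lift_functor_unique[OF A that(1) adjunctionD(2)[OF Y(2)] _ legs] that(2)
    by blast
  \<comment> \<open>Rewriting with \<open>slice_functor_leg\<close> brings the restriction functors,
    whatever their type instance, to the common form \<open>slice_leg\<close>.\<close>
  then show ?thesis
    using Y(1) pw legs maps unfolding powerful_def leg_simps slice_functor_leg by blast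
qed

end
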